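(* Let $F\subset S_{-1}$ be a set that does not contain (two distinct) congruent functions, and let $G=[F]$. Then: (1) the class $G$ has a finite basis if and only if $F$ is finite; (2) the class $G$ has no basis if and only if $F$ is infinite.
   Context: Functions of three-valued logic are maps $f(x_1,\ldots,x_n):\{0,1,2\}^n\to\{0,1,2\}$, $n\ge 1$, whose arguments are variables from a fixed countable alphabet. Two functions are congruent if one is obtained from the other by a bijective renaming of variables (without identification of variables). $R$ is the set of all functions $f(x_1,\ldots,x_n)$ of three-valued logic that take values in $\{0,1\}$ and equal $0$ on every tuple containing at least one component $0$. Put $N_f=\{\widetilde\alpha\in\{0,1,2\}^n\mid f(\widetilde\alpha)=1\}$. For integers $e,d\ge 0$ with $e+d=n$, the layer $\mathcal L(e,d)\subset\{1,2\}^n$ is the set of all tuples with exactly $e$ components equal to $1$ and $d$ components equal to $2$. $S_{-1}$ is the set of all $f(x_1,\ldots,x_n)\in R$ such that $N_f=\{1,2\}^n\setminus\mathcal L(e,d)$ for some $e,d\ge 0$, $e+d=n$. Formulas over a set $\mathfrak A$ of functions: variables are trivial formulas, and if $g\in\mathfrak A$ is $m$-ary and $\mathcal B_1,\ldots,\mathcal B_m$ are formulas over $\mathfrak A$ (possibly variables, possibly repeated), then $g(\mathcal B_1,\ldots,\mathcal B_m)$ is a (non-trivial) formula over $\mathfrak A$. The closure $[\mathfrak A]$ is the set of all functions realized by non-trivial formulas over $\mathfrak A$, regarded as functions of the variables occurring in the formula (projections and dummy variables are not added for free). A set $\mathfrak A$ is a basis of a closed class $G$ if $[\mathfrak A]=G$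 and no proper subset $\mathfrak A'\subsetneq\mathfrak A$ satisfies $[\mathfrak A']=G$. *)

theory Defs
  imports Main "HOL-Library.FuncSet"
begin

datatype trit = T0 | T1 | T2

text \<open>
  The countable alphabet of variables is \<^typ>\<open>nat\<close>. A tuple of values for the variables in \<open>V\<close> is an
  element of \<open>V \<rightarrow>\<^sub>E UNIV\<close>, so that \<open>{0,1,2}\<^sup>n\<close> is indexed by the variables themselves. A function
  \<open>f(x\<^sub>1,\<dots>,x\<^sub>n)\<close> is the set \<open>{x\<^sub>1,\<dots>,x\<^sub>n}\<close> of its variables together with its map, extensional outside
  the tuples over that set; hence two functions are equal iff they have the same variables
  (dummy ones included) and the same values.
\<close>

type_synonym tfun = "nat set \<times> ((nat \<Rightarrow> trit) \<Rightarrow> trit)"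

abbreviation tf_vars :: "tfun \<Rightarrow> nat set" where
  "tf_vars \<equiv> fst"

abbreviation tf_map :: "tfun \<Rightarrow> (nat \<Rightarrow> trit) \<Rightarrow> trit" where
  "tf_map \<equiv> snd"

definition tf_tuples :: "nat set \<Rightarrow> (nat \<Rightarrow> trit) set" where
  "tf_tuples V = V \<rightarrow>\<^sub>E UNIV"

definition P3 :: "tfun set" where
  "P3 = {f. finite (tf_vars f) \<and> tf_vars f \<noteq> {} \<and>
            tf_map f \<in> tf_tuples (tf_vars f) \<rightarrow>\<^sub>E UNIV}"

definition tf_rename :: "(nat \<Rightarrow> nat) \<Rightarrow> tfun \<Rightarrow> tfun" where
  "tf_rename \<pi> f =
     (\<pi> ` tf_vars f, \<lambda>a\<in>tf_tuples (\<pi> ` tf_vars f). tf_map f (\<lambda>x\<in>tf_vars f. a (\<pi> x)))"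

definition tf_congruent :: "tfun \<Rightarrow> tfun \<Rightarrow> bool" where
  "tf_congruent f g \<longleftrightarrow> (\<exists>\<pi>. inj_on \<pi> (tf_vars f) \<and> g = tf_rename \<pi> f)"

definition class_R :: "tfun set" where
  "class_R = {f \<in> P3. \<forall>a \<in> tf_tuples (tf_vars f).
                tf_map f a \<in> {T0, T1} \<and> ((\<exists>x \<in> tf_vars f. a x = T0) \<longrightarrow> tf_map f a = T0)}"

definition tf_N :: "tfun \<Rightarrow> (nat \<Rightarrow> trit) set" where
  "tf_N f = {a \<in> tf_tuples (tf_vars f). tf_map f a = T1}"

definition tf_layer :: "nat set \<Rightarrow> nat \<Rightarrow> nat \<Rightarrow> (nat \<Rightarrow> trit) set" where
  "tf_layer V e d =
     {a \<in> V \<rightarrow>\<^sub>E {T1, T2}. card {x \<in> V. a x = T1} = e \<and> card {x \<in> V. a x = T2} = d}"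

definition class_S_minus1 :: "tfun set" where
  "class_S_minus1 = {f \<in> class_R. \<exists>e d. e + d = card (tf_vars f) \<and>
     tf_N f = (tf_vars f \<rightarrow>\<^sub>E {T1, T2}) - tf_layer (tf_vars f) e d}"

text \<open>
  In \<open>FApp g \<sigma>\<close> the formula \<open>\<sigma> x\<close> is substituted for the variable \<open>x\<close> of \<open>g\<close>; the values of \<open>\<sigma>\<close> at
  other variables are irrelevant.
\<close>

datatype tformula = FVar nat | FApp tfun "nat \<Rightarrow> tformula"

primrec fm_over :: "tfun set \<Rightarrow> tformula \<Rightarrow> bool" where
  "fm_over A (FVar x) \<longleftrightarrow> True"
| "fm_over A (FApp g \<sigma>) \<longleftrightarrow> g \<in> A \<and> (\<forall>x \<in> tf_vars g. fm_over A (\<sigma> x))"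

primrec fm_vars :: "tformula \<Rightarrow> nat set" where
  "fm_vars (FVar x) = {x}"
| "fm_vars (FApp g \<sigma>) = (\<Union>x \<in> tf_vars g. fm_vars (\<sigma> x))"

primrec fm_eval :: "tformula \<Rightarrow> (nat \<Rightarrow> trit) \<Rightarrow> trit" where
  "fm_eval (FVar x) a = a x"
| "fm_eval (FApp g \<sigma>) a = tf_map g (\<lambda>x\<in>tf_vars g. fm_eval (\<sigma> x) a)"

definition fm_fun :: "tformula \<Rightarrow> tfun" where
  "fm_fun \<phi> = (fm_vars \<phi>, \<lambda>a\<in>tf_tuples (fm_vars \<phi>). fm_eval \<phi> a)"

definition fm_nontrivial :: "tformula \<Rightarrow> bool" where
  "fm_nontrivial \<phi> \<longleftrightarrow> (\<forall>x. \<phi> \<noteq> FVar x)"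

definition tf_closure :: "tfun set \<Rightarrow> tfun set" where
  "tf_closure A = {fm_fun \<phi> | \<phi>. fm_over A \<phi> \<and> fm_nontrivial \<phi>}"

definition tf_basis :: "tfun set \<Rightarrow> tfun set \<Rightarrow> bool" where
  "tf_basis A G \<longleftrightarrow>
     A \<subseteq> P3 \<and> tf_closure A = G \<and> (\<forall>A'. A' \<subset> A \<longrightarrow> tf_closure A' \<noteq> G)"

end

theory Submission imports Defs begin

text \<open>
  A function of \<open>S\<^sub>-\<^sub>1\<close> in \<open>n\<close> variables vanishes inside \<open>{1,2}\<^sup>n\<close> exactly on one layer, and every
  change of a single component between 1 and 2 leaves that layer. So such a zero cannot be certified
  by fewer than \<open>n\<close> components, whereas over functions of at most \<open>N\<close> variables every zero of a
  formula has a certificate of size \<open>N\<close>; in particular \<open>[F]\<close> is not finitely generated when \<open>F\<close> is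
  infinite. For the same reason a function \<open>b\<close> of a basis contributes no zero in \<open>{1,2}\<^sup>n\<close> to a
  formula for a member of \<open>F\<close> with more variables than \<open>b\<close>, and may be replaced there by the function that
  is 1 on the whole of \<open>{1,2}\<^sup>m\<close>, if \<open>[F]\<close> contains it. If it does not, then all layers of \<open>F\<close> consist
  of one tuple, and an innermost subformula already realizes the given function. Finally, all but
  finitely many members of \<open>F\<close> are generated by members of \<open>F\<close> with arbitrarily many variables.
  Hence a basis of \<open>[F]\<close> would contain a superfluous \<open>b\<close>: any function not needed for the finitely
  many exceptions and for the function constantly 1 on \<open>{1,2}\<^sup>2\<close>.
\<close>

section \<open>Formulas and closure\<close>

lemma fm_eval_cong:
  "(\<And>x. x \<in> fm_vars \<phi> \<Longrightarrow> a x = a' x) \<Longrightarrow> fm_eval \<phi> a = fm_eval \<phi> a'"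
proof (induction \<phi>)
  case (FApp g \<sigma>)
  have "(\<lambda>x\<in>tf_vars g. fm_eval (\<sigma> x) a) = (\<lambda>x\<in>tf_vars g. fm_eval (\<sigma> x) a')"
    using FApp by (intro restrict_ext) auto
  then show ?case by simp
qed simp

primrec fm_subst :: "(nat \<Rightarrow> tformula) \<Rightarrow> tformula \<Rightarrow> tformula" where
  "fm_subst \<tau> (FVar x) = \<tau> x"
| "fm_subst \<tau> (FApp g \<sigma>) = FApp g (\<lambda>x. fm_subst \<tau> (\<sigma> x))"

lemma fm_vars_subst: "fm_vars (fm_subst \<tau> \<phi>) = (\<Union>x\<in>fm_vars \<phi>. fm_vars (\<tau> x))"
  by (induction \<phi>) auto

lemma fm_eval_subst: "fm_eval (fm_subst \<tau> \<phi>) a = fm_eval \<phi> (\<lambda>x. fm_eval (\<tau> x) a)"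
  by (induction \<phi>) auto

lemma fm_over_subst:
  "fm_over A \<phi> \<Longrightarrow> (\<And>x. x \<in> fm_vars \<phi> \<Longrightarrow> fm_over A (\<tau> x)) \<Longrightarrow> fm_over A (fm_subst \<tau> \<phi>)"
  by (induction \<phi>) auto

lemma fm_nontrivial_simps [simp]: "\<not> fm_nontrivial (FVar x)" "fm_nontrivial (FApp g \<sigma>)"
  by (auto simp: fm_nontrivial_def)

lemma fm_nontrivialE: "fm_nontrivial \<phi> \<Longrightarrow> (\<And>g \<sigma>. \<phi> = FApp g \<sigma> \<Longrightarrow> P) \<Longrightarrow> P"
  by (cases \<phi>) auto

lemma fm_over_mono: "fm_over A \<phi> \<Longrightarrow> A \<subseteq> B \<Longrightarrow> fm_over B \<phi>"
  by (induction \<phi>) auto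

lemma tf_closure_mono: "A \<subseteq> B \<Longrightarrow> tf_closure A \<subseteq> tf_closure B"
  by (auto simp: tf_closure_def intro: fm_over_mono)

lemma restrict_in_tf_tuples [simp]: "restrict t V \<in> tf_tuples V"
  by (auto simp: tf_tuples_def)

lemma restrict_tf_tuples [simp]: "a \<in> tf_tuples V \<Longrightarrow> restrict a V = a"
  by (auto simp: tf_tuples_def)

lemma fst_fm_fun [simp]: "tf_vars (fm_fun \<phi>) = fm_vars \<phi>"
  by (simp add: fm_fun_def)

lemma fm_fun_restrict: "tf_map (fm_fun \<phi>) (restrict t (fm_vars \<phi>)) = fm_eval \<phi> t"
  by (auto simp: fm_fun_def intro: fm_eval_cong)

lemma P3_finite: "g \<in> P3 \<Longrightarrow> finite (tf_vars g)" and P3_nonempty: "g \<in> P3 \<Longrightarrow> tf_vars g \<noteq> {}"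
  by (auto simp: P3_def)

text \<open>Each tuple over the variables is its own restriction, so total assignments
  \<open>t\<close>, the kind that \<open>fm_eval\<close> takes, reach all tuples; elsewhere both
  maps are \<open>undefined\<close>.\<close>

lemma P3_eqI:
  assumes "f \<in> P3" "g \<in> P3" "tf_vars f = tf_vars g"
    and "\<And>t. tf_map f (restrict t (tf_vars f)) = tf_map g (restrict t (tf_vars f))"
  shows "f = g"
proof (rule prod_eqI)
  show "tf_map f = tf_map g"
  proof
    fix a
    show "tf_map f a = tf_map g a"
    proof (cases "a \<in> tf_tuples (tf_vars f)")
      case True
      then show ?thesis using assms(4)[of a] by simp
    next
      case False
      then show ?thesis using assms(1-3) by (auto simp: P3_def PiE_def extensional_def)
    qed
  qed
qed (use assms in simp)

lemma finite_fm_vars: "A \<subseteq> P3 \<Longrightarrow> fm_over A \<phi> \<Longrightarrow> finite (fm_vars \<phi>)"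
proof (induction \<phi>)
  case (FApp g \<sigma>)
  then have "finite (tf_vars g)" using P3_finite[of g] by auto
  then show ?case using FApp by auto
qed simp

lemma fm_vars_nonempty: "A \<subseteq> P3 \<Longrightarrow> fm_over A \<phi> \<Longrightarrow> fm_vars \<phi> \<noteq> {}"
proof (induction \<phi>)
  case (FApp g \<sigma>)
  then have "tf_vars g \<noteq> {}" using P3_nonempty[of g] by auto
  then show ?case using FApp by auto
qed simp

lemma fm_fun_in_P3: "A \<subseteq> P3 \<Longrightarrow> fm_over A \<phi> \<Longrightarrow> fm_fun \<phi> \<in> P3"
  using finite_fm_vars[of A \<phi>] fm_vars_nonempty[of A \<phi>] by (auto simp: P3_def fm_fun_def)

lemma tf_closure_P3: "A \<subseteq> P3 \<Longrightarrow> tf_closure A \<subseteq> P3"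
  by (auto simp: tf_closure_def fm_fun_in_P3)

lemma tf_closureI:
  assumes "A \<subseteq> P3" "f \<in> P3" "fm_over A \<phi>" "fm_nontrivial \<phi>" "fm_vars \<phi> = tf_vars f"
    and "\<And>t. fm_eval \<phi> t = tf_map f (restrict t (tf_vars f))"
  shows "f \<in> tf_closure A"
proof -
  have "f = fm_fun \<phi>"
    using assms fm_fun_restrict[of \<phi>] by (intro P3_eqI) (auto intro: fm_fun_in_P3)
  then show ?thesis using assms by (auto simp: tf_closure_def)
qed

lemma tf_closureE:
  assumes "f \<in> tf_closure A"
  obtains \<phi> where "fm_over A \<phi>" "fm_nontrivial \<phi>" "fm_vars \<phi> = tf_vars f"
    "\<And>t. fm_eval \<phi> t = tf_map f (restrict t (tf_vars f))"
  using assms unfolding tf_closure_def by (force simp: fm_fun_restrict)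

lemma subset_tf_closure: "A \<subseteq> P3 \<Longrightarrow> A \<subseteq> tf_closure A"
proof
  fix f assume "A \<subseteq> P3" "f \<in> A"
  then show "f \<in> tf_closure A"
    by (intro tf_closureI[where \<phi> = "FApp f FVar"]) auto
qed

text \<open>Every applied function of the closure is unfolded into a formula over \<open>A\<close>
  realizing it, and the unfolded arguments are substituted there. Nontriviality is only an
  implication because arguments may be variables.\<close>

lemma fm_over_tf_closure:
  "fm_over (tf_closure A) \<phi> \<Longrightarrow>
     \<exists>\<psi>. fm_over A \<psi> \<and> (fm_nontrivial \<phi> \<longrightarrow> fm_nontrivial \<psi>) \<and> fm_vars \<psi> = fm_vars \<phi> \<and>
         (\<forall>a. fm_eval \<psi> a = fm_eval \<phi> a)"
proof (induction \<phi>)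
  case (FVar x)
  then show ?case by (intro exI[of _ "FVar x"]) auto
next
  case (FApp g \<sigma>)
  then have "g \<in> tf_closure A" by simp
  then obtain \<chi> where \<chi>: "fm_over A \<chi>" "fm_nontrivial \<chi>" "fm_vars \<chi> = tf_vars g"
    "\<And>t. fm_eval \<chi> t = tf_map g (restrict t (tf_vars g))"
    by (rule tf_closureE) (rule that)
  have "\<forall>x\<in>tf_vars g. \<exists>\<psi>. fm_over A \<psi> \<and> fm_vars \<psi> = fm_vars (\<sigma> x) \<and>
         (\<forall>a. fm_eval \<psi> a = fm_eval (\<sigma> x) a)"
    using FApp by (metis fm_over.simps(2) rangeI)
  then obtain \<tau> where \<tau>: "\<forall>x\<in>tf_vars g. fm_over A (\<tau> x) \<and> fm_vars (\<tau> x) = fm_vars (\<sigma> x) \<and>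
         (\<forall>a. fm_eval (\<tau> x) a = fm_eval (\<sigma> x) a)"
    by metis
  have "fm_nontrivial (fm_subst \<tau> \<chi>)"
    using \<chi>(2) by (auto elim: fm_nontrivialE)
  moreover have "fm_eval (fm_subst \<tau> \<chi>) a = fm_eval (FApp g \<sigma>) a" for a
    using \<tau> by (auto simp: fm_eval_subst \<chi>(4) intro!: arg_cong[where f = "tf_map g"])
  ultimately show ?case
    using \<chi> \<tau> by (intro exI[of _ "fm_subst \<tau> \<chi>"]) (auto simp: fm_vars_subst intro: fm_over_subst)
qed

lemma tf_closure_idem: "tf_closure (tf_closure A) \<subseteq> tf_closure A"
proof
  fix f assume "f \<in> tf_closure (tf_closure A)"
  then obtain \<phi> where "fm_over (tf_closure A) \<phi>" "fm_nontrivial \<phi>" "f = fm_fun \<phi>"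
    by (auto simp: tf_closure_def)
  with fm_over_tf_closure[of A \<phi>] obtain \<psi> where "fm_over A \<psi>" "fm_nontrivial \<psi>"
    "fm_vars \<psi> = fm_vars \<phi>" "\<forall>a. fm_eval \<psi> a = fm_eval \<phi> a"
    by auto
  moreover from this have "fm_fun \<psi> = f"
    using \<open>f = fm_fun \<phi>\<close> by (simp add: fm_fun_def)
  ultimately show "f \<in> tf_closure A"
    by (auto simp: tf_closure_def)
qed

lemma tf_closure_subsetI: "A \<subseteq> tf_closure B \<Longrightarrow> tf_closure A \<subseteq> tf_closure B"
  using tf_closure_mono tf_closure_idem by blast

text \<open>Only the arguments at variables of the applied function count, so membership in
  \<open>P3\<close> makes the relevant part of a formula a finite tree.\<close>

lemma fm_over_finite:
  "A \<subseteq> P3 \<Longrightarrow> fm_over A \<phi> \<Longrightarrow> \<exists>A0. finite A0 \<and> A0 \<subseteq> A \<and> fm_over A0 \<phi>"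
proof (induction \<phi>)
  case (FApp g \<sigma>)
  have "\<forall>x\<in>tf_vars g. \<exists>A0. finite A0 \<and> A0 \<subseteq> A \<and> fm_over A0 (\<sigma> x)"
    using FApp by auto
  then obtain S where S: "\<forall>x\<in>tf_vars g. finite (S x) \<and> S x \<subseteq> A \<and> fm_over (S x) (\<sigma> x)"
    by metis
  have "finite (tf_vars g)" using FApp.prems P3_finite[of g] by auto
  then show ?case using S FApp.prems
    by (intro exI[of _ "insert g (\<Union>x\<in>tf_vars g. S x)"]) (auto intro: fm_over_mono[of "S _"])
qed auto

lemma tf_closure_finite_subset:
  assumes "A \<subseteq> P3" "finite H" "H \<subseteq> tf_closure A"
  shows "\<exists>A0. finite A0 \<and> A0 \<subseteq> A \<and> H \<subseteq> tf_closure A0"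
proof -
  have "\<forall>h\<in>H. \<exists>A0. finite A0 \<and> A0 \<subseteq> A \<and> h \<in> tf_closure A0"
  proof
    fix h assume "h \<in> H"
    then obtain \<phi> where \<phi>: "fm_over A \<phi>" "fm_nontrivial \<phi>" "h = fm_fun \<phi>"
      using assms by (auto simp: tf_closure_def)
    with fm_over_finite[OF assms(1) \<phi>(1)] show "\<exists>A0. finite A0 \<and> A0 \<subseteq> A \<and> h \<in> tf_closure A0"
      by (auto simp: tf_closure_def)
  qed
  then obtain S where S: "\<forall>h\<in>H. finite (S h) \<and> S h \<subseteq> A \<and> h \<in> tf_closure (S h)"
    by metis
  have "h \<in> tf_closure (\<Union>(S ` H))" if "h \<in> H" for h
    using S that tf_closure_mono[of "S h" "\<Union>(S ` H)"] by auto
  then show ?thesis using S assms(2) by (intro exI[of _ "\<Union>(S ` H)"]) auto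
qed

section \<open>Functions of the class R\<close>

lemma class_R_P3: "class_R \<subseteq> P3"
  by (auto simp: class_R_def)

lemma class_R_values: "g \<in> class_R \<Longrightarrow> tf_map g (restrict t (tf_vars g)) \<in> {T0, T1}"
  by (simp add: class_R_def)

lemma class_R_zero:
  assumes "g \<in> class_R" "x \<in> tf_vars g" "t x = T0"
  shows "tf_map g (restrict t (tf_vars g)) = T0"
proof -
  have "restrict t (tf_vars g) x = T0" using assms by simp
  moreover have "\<forall>a\<in>tf_tuples (tf_vars g). (\<exists>x\<in>tf_vars g. a x = T0) \<longrightarrow> tf_map g a = T0"
    using assms(1) by (simp add: class_R_def)
  ultimately show ?thesis using assms(2) restrict_in_tf_tuples by blast
qed

lemma fm_eval_values:
  "A \<subseteq> class_R \<Longrightarrow> fm_over A \<phi> \<Longrightarrow> fm_nontrivial \<phi> \<Longrightarrow> fm_eval \<phi> a \<in> {T0, T1}"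
  using class_R_values by (cases \<phi>) auto

lemma fm_eval_zero:
  "A \<subseteq> class_R \<Longrightarrow> fm_over A \<phi> \<Longrightarrow> x \<in> fm_vars \<phi> \<Longrightarrow> a x = T0 \<Longrightarrow> fm_eval \<phi> a = T0"
proof (induction \<phi>)
  case (FApp g \<sigma>)
  then obtain y where "y \<in> tf_vars g" "fm_eval (\<sigma> y) a = T0" by auto
  then show ?case using class_R_zero[of g y "\<lambda>x. fm_eval (\<sigma> x) a"] FApp.prems by auto
qed simp

lemma tf_closure_class_R:
  assumes "A \<subseteq> class_R"
  shows "tf_closure A \<subseteq> class_R"
proof
  fix f assume f: "f \<in> tf_closure A"
  then obtain \<phi> where \<phi>: "fm_over A \<phi>" "fm_nontrivial \<phi>" "fm_vars \<phi> = tf_vars f"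
    "\<And>t. fm_eval \<phi> t = tf_map f (restrict t (tf_vars f))"
    by (rule tf_closureE) (rule that)
  have "f \<in> P3" using f assms tf_closure_P3 class_R_P3 by blast
  moreover have "tf_map f a \<in> {T0, T1} \<and> ((\<exists>x \<in> tf_vars f. a x = T0) \<longrightarrow> tf_map f a = T0)"
    if "a \<in> tf_tuples (tf_vars f)" for a
    using \<phi>(3) \<phi>(4)[of a] that fm_eval_values[OF assms \<phi>(1,2), of a] fm_eval_zero[OF assms \<phi>(1), of _ a]
    by auto
  ultimately show "f \<in> class_R" by (auto simp: class_R_def)
qed

text \<open>Within \<open>{1,2}\<^sup>V\<close> a tuple is identified with the set of variables at which it equals 2;
  \<open>Z\<close> collects the tuples at which the function vanishes.\<close>

definition rfun :: "nat set \<Rightarrow> nat set set \<Rightarrow> tfun" where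
  "rfun V Z = (V, \<lambda>a\<in>tf_tuples V.
     if (\<forall>x\<in>V. a x \<noteq> T0) \<and> {x \<in> V. a x = T2} \<notin> Z then T1 else T0)"

text \<open>For finite nonempty \<open>V\<close> and \<open>d\<close> at most \<open>card V\<close>,
  this is the member of S_{-1} whose omitted layer is L(card V - d, d).\<close>

abbreviation layer_fun :: "nat set \<Rightarrow> nat \<Rightarrow> tfun" where
  "layer_fun V d \<equiv> rfun V {T. card T = d}"

text \<open>What remains of a function of R on \<open>V\<close> when its zeros inside {1,2}^V are
  erased.\<close>

abbreviation support_fun :: "nat set \<Rightarrow> tfun" where
  "support_fun V \<equiv> rfun V {}"

lemma fst_rfun [simp]: "tf_vars (rfun V Z) = V"
  by (simp add: rfun_def)

lemma rfun_restrict [simp]: "tf_map (rfun V Z) (restrict t V) =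
    (if (\<forall>x\<in>V. t x \<noteq> T0) \<and> {x \<in> V. t x = T2} \<notin> Z then T1 else T0)"
proof -
  have "{x \<in> V. restrict t V x = T2} = {x \<in> V. t x = T2}" by auto
  then show ?thesis by (simp add: rfun_def)
qed

lemma rfun_P3: "finite V \<Longrightarrow> V \<noteq> {} \<Longrightarrow> rfun V Z \<in> P3"
  by (auto simp: P3_def rfun_def)

lemma trit_cases_nonzero: "t \<noteq> T0 \<longleftrightarrow> t \<in> {T1, T2}"
  by (cases t) auto

text \<open>On a tuple without 0 the numbers of ones and twos add up to \<open>card V\<close>, so
  the number of twos alone decides membership in the layer.\<close>

lemma class_S_minus1_layer_fun:
  assumes "f \<in> class_S_minus1"
  shows "\<exists>d \<le> card (tf_vars f). f = layer_fun (tf_vars f) d"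
proof -
  define V where "V = tf_vars f"
  from assms obtain e d where ed: "e + d = card V" and R: "f \<in> class_R"
    and N: "tf_N f = (V \<rightarrow>\<^sub>E {T1, T2}) - tf_layer V e d"
    by (auto simp: class_S_minus1_def V_def)
  have P: "f \<in> P3" using R class_R_P3 by blast
  have V: "finite V" "V \<noteq> {}" using P P3_finite P3_nonempty V_def by auto
  have "f = layer_fun V d"
  proof (rule P3_eqI)
    fix t :: "nat \<Rightarrow> trit"
    let ?a = "restrict t V"
    have 1: "tf_map f ?a = T1 \<longleftrightarrow> ?a \<in> tf_N f" by (auto simp: tf_N_def V_def)
    have 2: "?a \<in> V \<rightarrow>\<^sub>E {T1, T2} \<longleftrightarrow> (\<forall>x\<in>V. t x \<noteq> T0)"
      by (auto simp: trit_cases_nonzero)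
    have 3: "{x \<in> V. ?a x = c} = {x \<in> V. t x = c}" for c by auto
    have 4: "card {x \<in> V. t x = T1} + card {x \<in> V. t x = T2} = card V" if "\<forall>x\<in>V. t x \<noteq> T0"
    proof -
      have "card ({x \<in> V. t x = T1} \<union> {x \<in> V. t x = T2}) =
          card {x \<in> V. t x = T1} + card {x \<in> V. t x = T2}"
        using V by (intro card_Un_disjoint) auto
      moreover have "{x \<in> V. t x = T1} \<union> {x \<in> V. t x = T2} = V"
        using that by (auto simp: trit_cases_nonzero)
      ultimately show ?thesis by simp
    qed
    have "tf_map f ?a = T1 \<longleftrightarrow> (\<forall>x\<in>V. t x \<noteq> T0) \<and> card {x \<in> V. t x = T2} \<noteq> d"
      unfolding 1 N tf_layer_def using 2 3 4 ed by auto
    moreover have "tf_map f ?a \<in> {T0, T1}" using class_R_values[OF R] V_def by simp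
    ultimately show "tf_map f (restrict t (tf_vars f)) =
        tf_map (layer_fun V d) (restrict t (tf_vars f))"
      unfolding V_def[symmetric] by auto
  qed (use P V in \<open>auto simp: V_def[symmetric] intro: rfun_P3\<close>)
  then show ?thesis using ed V_def by (intro exI[of _ d]) auto
qed

text \<open>A bijective renaming preserves the number of twos. Hence non-congruent members of
  \<open>F\<close> have different parameters.\<close>

lemma layer_fun_congruent:
  assumes "finite V" "finite W" "V \<noteq> {}" "W \<noteq> {}" "card V = card W"
  shows "tf_congruent (layer_fun V d) (layer_fun W d)"
proof -
  obtain \<pi> where \<pi>: "bij_betw \<pi> V W" using assms finite_same_card_bij by blast
  have W: "\<pi> ` V = W" using \<pi> by (auto simp: bij_betw_def)
  have "layer_fun W d = tf_rename \<pi> (layer_fun V d)"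
  proof (rule P3_eqI)
    fix t
    have "{y \<in> W. t y = T2} = \<pi> ` {x \<in> V. t (\<pi> x) = T2}" using W by auto
    then have "card {y \<in> W. t y = T2} = card {x \<in> V. t (\<pi> x) = T2}"
      using \<pi> by (auto simp: bij_betw_def inj_on_def intro!: card_image)
    moreover have "(\<lambda>x\<in>V. restrict t W (\<pi> x)) = (\<lambda>x\<in>V. t (\<pi> x))"
      using W by (intro restrict_ext) auto
    then have "tf_map (tf_rename \<pi> (layer_fun V d)) (restrict t W) =
        tf_map (layer_fun V d) (\<lambda>x\<in>V. t (\<pi> x))"
      by (simp only: tf_rename_def W fst_rfun snd_conv restrict_in_tf_tuples restrict_apply' if_True)
    moreover have "(\<forall>y\<in>W. t y \<noteq> T0) \<longleftrightarrow> (\<forall>x\<in>V. t (\<pi> x) \<noteq> T0)" using W by auto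
    ultimately show "tf_map (layer_fun W d) (restrict t (tf_vars (layer_fun W d))) =
        tf_map (tf_rename \<pi> (layer_fun V d)) (restrict t (tf_vars (layer_fun W d)))"
      by (simp only: fst_rfun rfun_restrict mem_Collect_eq)
  qed (use assms W in \<open>auto simp: tf_rename_def P3_def rfun_def\<close>)
  then show ?thesis using \<pi> by (auto simp: tf_congruent_def bij_betw_def)
qed

section \<open>Zero certificates\<close>

text \<open>For finitely many variables this bounds by \<open>N\<close> the 0-certificate complexity
  known from decision trees.\<close>

definition zero_cert :: "nat \<Rightarrow> tfun \<Rightarrow> bool" where
  "zero_cert N g \<longleftrightarrow> (\<forall>t. tf_map g (restrict t (tf_vars g)) = T0 \<longrightarrow>
     (\<exists>U\<subseteq>tf_vars g. card U \<le> N \<and>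
        (\<forall>t'. (\<forall>x\<in>U. t' x = t x) \<longrightarrow> tf_map g (restrict t' (tf_vars g)) = T0)))"

text \<open>Functions in \<open>Z\<close> keep only the zeros forced by an argument 0.\<close>

primrec fm_relax :: "tfun set \<Rightarrow> tformula \<Rightarrow> tformula" where
  "fm_relax Z (FVar x) = FVar x"
| "fm_relax Z (FApp g \<sigma>) =
     FApp (if g \<in> Z then support_fun (tf_vars g) else g) (\<lambda>x. fm_relax Z (\<sigma> x))"

lemma fm_vars_relax [simp]: "fm_vars (fm_relax Z \<phi>) = fm_vars \<phi>"
  by (induction \<phi>) auto

lemma fm_nontrivial_relax [simp]: "fm_nontrivial (fm_relax Z \<phi>) = fm_nontrivial \<phi>"
  by (cases \<phi>) auto

lemma fm_over_relax:
  "fm_over A \<phi> \<Longrightarrow> A - Z \<subseteq> C \<Longrightarrow> (\<And>g. g \<in> A \<inter> Z \<Longrightarrow> support_fun (tf_vars g) \<in> C) \<Longrightarrow>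
     fm_over C (fm_relax Z \<phi>)"
  by (induction \<phi>) auto

text \<open>A nonzero value of an application forces all its arguments to be nonzero, and then the
  original and the relaxed function both give 1. So relaxing can only remove zeros.\<close>

lemma fm_eval_relax:
  "A \<subseteq> class_R \<Longrightarrow> fm_over A \<phi> \<Longrightarrow> fm_eval \<phi> a \<noteq> T0 \<Longrightarrow> fm_eval (fm_relax Z \<phi>) a = fm_eval \<phi> a"
proof (induction \<phi>)
  case (FApp g \<sigma>)
  have R: "g \<in> class_R" using FApp.prems by auto
  have nz: "fm_eval (\<sigma> x) a \<noteq> T0" if "x \<in> tf_vars g" for x
    using class_R_zero[OF R that, of "\<lambda>x. fm_eval (\<sigma> x) a"] FApp.prems(3) by auto
  have "fm_eval (fm_relax Z (\<sigma> x)) a = fm_eval (\<sigma> x) a" if "x \<in> tf_vars g" for x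
    using FApp nz that by auto
  then have eq: "(\<lambda>x\<in>tf_vars g. fm_eval (fm_relax Z (\<sigma> x)) a) = (\<lambda>x\<in>tf_vars g. fm_eval (\<sigma> x) a)"
    by (intro restrict_ext) auto
  have "fm_eval (FApp g \<sigma>) a = T1"
    using class_R_values[OF R, of "\<lambda>x. fm_eval (\<sigma> x) a"] FApp.prems(3) by auto
  then show ?case using nz eq by simp
qed simp

text \<open>A zero of a formula is either already a zero of the relaxed formula, or it is produced at an
  application of a function from \<open>Z\<close> whose arguments are all nonzero. In the latter case the
  nontrivial arguments have value 1, and changing them to 0 keeps the zero, so only the arguments
  that are variables have to be certified.\<close>

lemma fm_zero_cert:
  assumes "A \<subseteq> class_R" "\<And>g. g \<in> A \<inter> Z \<Longrightarrow> zero_cert N g"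
  shows "fm_over A \<phi> \<Longrightarrow> fm_eval \<phi> a = T0 \<Longrightarrow> fm_eval (fm_relax Z \<phi>) a = T0 \<or>
    (\<exists>U\<subseteq>fm_vars \<phi>. card U \<le> N \<and> (\<forall>a'. (\<forall>x\<in>U. a' x = a x) \<longrightarrow> fm_eval \<phi> a' = T0))"
proof (induction \<phi>)
  case (FApp g \<sigma>)
  have R: "g \<in> class_R" using FApp.prems assms by auto
  have fin: "finite (tf_vars g)" using R class_R_P3 P3_finite by blast
  have zero: "fm_eval (FApp g \<sigma>) b = T0" if "x \<in> tf_vars g" "fm_eval (\<sigma> x) b = T0" for x b
    using class_R_zero[OF R that(1), of "\<lambda>x. fm_eval (\<sigma> x) b"] that by auto
  show ?case
  proof (cases "\<exists>x\<in>tf_vars g. fm_eval (\<sigma> x) a = T0")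
    case True
    then obtain x where x: "x \<in> tf_vars g" "fm_eval (\<sigma> x) a = T0" by auto
    then consider "fm_eval (fm_relax Z (\<sigma> x)) a = T0" |
      U where "U\<subseteq>fm_vars (\<sigma> x)" "card U \<le> N" "\<forall>a'. (\<forall>x\<in>U. a' x = a x) \<longrightarrow> fm_eval (\<sigma> x) a' = T0"
      using FApp.IH[of "\<sigma> x"] FApp.prems by auto
    then show ?thesis
    proof cases
      case 1
      then have "fm_eval (fm_relax Z (FApp g \<sigma>)) a = T0"
        using x class_R_zero[OF R x(1), of "\<lambda>x. fm_eval (fm_relax Z (\<sigma> x)) a"] by auto
      then show ?thesis ..
    next
      case 2
      then show ?thesis using zero[OF x(1)] x(1)
        by (intro disjI2 exI[of _ U] conjI allI impI) auto
    qed
  next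
    case False
    have eq: "(\<lambda>x\<in>tf_vars g. fm_eval (fm_relax Z (\<sigma> x)) a) = (\<lambda>x\<in>tf_vars g. fm_eval (\<sigma> x) a)"
      using False FApp.prems fm_eval_relax[OF assms(1)] by (intro restrict_ext) auto
    show ?thesis
    proof (cases "g \<in> Z")
      case False
      then show ?thesis using eq FApp.prems by simp
    next
      case True
      then have "zero_cert N g" using assms FApp.prems by auto
      then obtain U where U: "U \<subseteq> tf_vars g" "card U \<le> N"
        "\<And>t'. (\<forall>x\<in>U. t' x = fm_eval (\<sigma> x) a) \<Longrightarrow> tf_map g (restrict t' (tf_vars g)) = T0"
        using FApp.prems(2) unfolding zero_cert_def fm_eval.simps by meson
      have finU: "finite U" using U(1) fin finite_subset by blast
      define U' where "U' = {y. \<exists>x\<in>U. \<sigma> x = FVar y}"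
      \<comment> \<open>The image under \<open>THE\<close> shows that \<open>U'\<close> has at most
        as many elements as \<open>U\<close>.\<close>
      have sub: "U' \<subseteq> (\<lambda>x. THE y. \<sigma> x = FVar y) ` U"
        unfolding U'_def by (force simp: image_iff)
      have "card U' \<le> N"
        using surj_card_le[OF finU sub] U(2) by simp
      moreover have "U' \<subseteq> fm_vars (FApp g \<sigma>)" using U(1) by (force simp: U'_def)
      moreover have "fm_eval (FApp g \<sigma>) a' = T0" if ag: "\<forall>x\<in>U'. a' x = a x" for a'
      proof (cases "\<exists>x\<in>tf_vars g. fm_eval (\<sigma> x) a' = T0")
        case True
        then show ?thesis using zero by auto
      next
        case nz': False
        \<comment> \<open>Variable arguments agree by the choice of \<open>U'\<close>; nontrivial
          ones lie in {0,1} and are nonzero under both assignments, hence equal 1.\<close>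
        have "fm_eval (\<sigma> x) a' = fm_eval (\<sigma> x) a" if "x \<in> U" for x
        proof (cases "\<sigma> x")
          case (FVar y)
          then show ?thesis using ag that by (auto simp: U'_def)
        next
          case (FApp h \<tau>)
          have x: "x \<in> tf_vars g" using that U by auto
          then have v: "fm_eval (\<sigma> x) b \<in> {T0, T1}" for b
            using FApp FApp.prems by (intro fm_eval_values[OF assms(1)]) auto
          have "fm_eval (\<sigma> x) a \<noteq> T0" "fm_eval (\<sigma> x) a' \<noteq> T0"
            using nz' False x by blast+
          then show ?thesis using v[of a] v[of a'] by simp
        qed
        then show ?thesis using U(3)[of "\<lambda>x. fm_eval (\<sigma> x) a'"] by auto
      qed
      ultimately show ?thesis by blast
    qed
  qed
qed simp

lemma fm_relax_UNIV_zero: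
  "fm_eval (fm_relax UNIV \<phi>) a = T0 \<Longrightarrow> \<exists>x\<in>fm_vars \<phi>. a x = T0"
  by (induction \<phi>) (force split: if_splits)+

text \<open>Relax all functions at once. A zero that survives comes from a single variable with
  value 0, which is a certificate of size 1; this is where \<open>N\<close> must be
  positive.\<close>

lemma zero_cert_closure:
  assumes "A \<subseteq> class_R" "\<And>g. g \<in> A \<Longrightarrow> zero_cert N g" "N \<ge> 1" "f \<in> tf_closure A"
  shows "zero_cert N f"
proof -
  obtain \<phi> where \<phi>: "fm_over A \<phi>" "fm_vars \<phi> = tf_vars f"
    "\<And>t. fm_eval \<phi> t = tf_map f (restrict t (tf_vars f))"
    using assms(4) by (rule tf_closureE) (rule that)
  have "\<exists>U\<subseteq>fm_vars \<phi>. card U \<le> N \<and> (\<forall>a'. (\<forall>x\<in>U. a' x = a x) \<longrightarrow> fm_eval \<phi> a' = T0)"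
    if a: "fm_eval \<phi> a = T0" for a
  proof -
    consider "fm_eval (fm_relax UNIV \<phi>) a = T0" |
      "\<exists>U\<subseteq>fm_vars \<phi>. card U \<le> N \<and> (\<forall>a'. (\<forall>x\<in>U. a' x = a x) \<longrightarrow> fm_eval \<phi> a' = T0)"
      using fm_zero_cert[OF assms(1), of UNIV N \<phi> a] assms(2) \<phi>(1) a by blast
    then show ?thesis
    proof cases
      case 1
      then obtain x where "x \<in> fm_vars \<phi>" "a x = T0" using fm_relax_UNIV_zero by blast
      then show ?thesis using assms(3) fm_eval_zero[OF assms(1) \<phi>(1)]
        by (intro exI[of _ "{x}"]) auto
    qed
  qed
  then show ?thesis by (simp add: zero_cert_def \<phi>(2,3))
qed

lemma zero_cert_card: "card (tf_vars g) \<le> N \<Longrightarrow> zero_cert N g"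
proof (unfold zero_cert_def, intro allI impI exI conjI)
  fix t t'
  assume "tf_map g (restrict t (tf_vars g)) = T0" "\<forall>x\<in>tf_vars g. t' x = t x"
  moreover from this have "restrict t' (tf_vars g) = restrict t (tf_vars g)"
    by (intro restrict_ext) auto
  ultimately show "tf_map g (restrict t' (tf_vars g)) = T0" by (simp only:)
qed auto

text \<open>Some variable of \<open>V\<close> lies outside \<open>U\<close>; flipping it between 1
  and 2 changes the number of twos by one.\<close>

lemma layer_fun_toggle:
  assumes "finite V" "U \<subseteq> V" "card U < card V" "\<forall>x\<in>V. t x \<noteq> T0" "card {x \<in> V. t x = T2} = d"
  shows "\<exists>t'. (\<forall>x\<in>U. t' x = t x) \<and> tf_map (layer_fun V d) (restrict t' V) = T1"
proof -
  obtain y where y: "y \<in> V" "y \<notin> U" using assms by (metis less_irrefl subset_antisym subset_iff)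
  define t' where "t' = t(y := if t y = T1 then T2 else T1)"
  have fin: "finite {x \<in> V. t x = T2}" using assms by simp
  have "card {x \<in> V. t' x = T2} \<noteq> d"
  proof (cases "t y = T1")
    case True
    then have "{x \<in> V. t' x = T2} = insert y {x \<in> V. t x = T2}" "y \<notin> {x \<in> V. t x = T2}"
      using y by (auto simp: t'_def)
    then show ?thesis using assms(5) fin by simp
  next
    case False
    then have "t y = T2" using assms(4) y by (auto simp: trit_cases_nonzero)
    then have "{x \<in> V. t x = T2} = insert y {x \<in> V. t' x = T2}" "y \<notin> {x \<in> V. t' x = T2}"
      using y by (auto simp: t'_def)
    then show ?thesis using assms(1,5) by auto
  qed
  moreover have "\<forall>x\<in>V. t' x \<noteq> T0" using assms(4) by (auto simp: t'_def)
  ultimately show ?thesis using y by (intro exI[of _ t']) (auto simp: t'_def)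
qed

lemma not_zero_cert_layer_fun:
  assumes "finite V" "N < card V" "d \<le> card V"
  shows "\<not> zero_cert N (layer_fun V d)"
proof
  assume cert: "zero_cert N (layer_fun V d)"
  obtain T where T: "T \<subseteq> V" "card T = d" using assms(3) by (meson obtain_subset_with_card_n)
  define t where "t = (\<lambda>x. if x \<in> T then T2 else T1)"
  have tT: "{x \<in> V. t x = T2} = T" using T by (auto simp: t_def)
  then have "tf_map (layer_fun V d) (restrict t V) = T0" using T by simp
  then obtain U where U: "U \<subseteq> V" "card U \<le> N"
    "\<forall>t'. (\<forall>x\<in>U. t' x = t x) \<longrightarrow> tf_map (layer_fun V d) (restrict t' V) = T0"
    using cert unfolding zero_cert_def fst_rfun by blast
  have "\<forall>x\<in>V. t x \<noteq> T0" by (auto simp: t_def)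
  then obtain t' where "\<forall>x\<in>U. t' x = t x" "tf_map (layer_fun V d) (restrict t' V) = T1"
    using layer_fun_toggle[of V U t d] assms U tT T by auto
  then show False using U(3) by (metis trit.distinct(1))
qed

text \<open>Relax \<open>b\<close> in a formula for the layer function. A zero lost inside {1,2}^V
  would have a certificate smaller than \<open>V\<close>, which toggling refutes; zeros at tuples
  with a component 0 persist because the relaxed formula is still over R. So the function is
  unchanged.\<close>

lemma layer_fun_closure_relax:
  assumes "B \<subseteq> class_R" "layer_fun V d \<in> tf_closure B" "finite V" "V \<noteq> {}" "N < card V"
    and "zero_cert N b" "support_fun (tf_vars b) \<in> tf_closure (B - {b})"
  shows "layer_fun V d \<in> tf_closure (B - {b})"
proof -
  obtain \<phi> where \<phi>: "fm_over B \<phi>" "fm_nontrivial \<phi>" "fm_vars \<phi> = V"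
    "\<And>t. fm_eval \<phi> t = tf_map (layer_fun V d) (restrict t V)"
    using assms(2) by (rule tf_closureE[where f = "layer_fun V d", unfolded fst_rfun]) (rule that)
  let ?C = "tf_closure (B - {b})"
  have BP: "B - {b} \<subseteq> P3" using assms(1) class_R_P3 by blast
  have CR: "?C \<subseteq> class_R" using assms(1) by (intro tf_closure_class_R) auto
  have over: "fm_over ?C (fm_relax {b} \<phi>)"
    using \<phi>(1) subset_tf_closure[OF BP] assms(7) by (intro fm_over_relax) auto
  have "layer_fun V d \<in> tf_closure ?C"
  proof (rule tf_closureI[where \<phi> = "fm_relax {b} \<phi>"])
    fix t
    have "fm_eval (fm_relax {b} \<phi>) t = fm_eval \<phi> t"
    proof (cases "fm_eval \<phi> t = T0")
      case False
      then show ?thesis using fm_eval_relax[OF assms(1) \<phi>(1)] by simp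
    next
      case True
      show ?thesis
      proof (cases "\<exists>x\<in>V. t x = T0")
        case True
        then show ?thesis
          using fm_eval_zero[OF CR over, of _ t] \<open>fm_eval \<phi> t = T0\<close> \<phi>(3) by auto
      next
        case False
        then have layer: "card {x \<in> V. t x = T2} = d" using True unfolding \<phi>(4)
          by (auto split: if_splits)
        consider "fm_eval (fm_relax {b} \<phi>) t = T0" |
          U where "U\<subseteq>V" "card U \<le> N" "\<forall>a'. (\<forall>x\<in>U. a' x = t x) \<longrightarrow> fm_eval \<phi> a' = T0"
          using fm_zero_cert[OF assms(1), of "{b}" N \<phi> t] assms(6) \<phi>(1,3) True by blast
        then show ?thesis
        proof cases
          case 1
          then show ?thesis using True by simp
        next
          case 2
          then obtain t' where "\<forall>x\<in>U. t' x = t x" "tf_map (layer_fun V d) (restrict t' V) = T1"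
            using layer_fun_toggle[of V U t d] assms False layer by auto
          then show ?thesis using 2(3) \<phi>(4) by (metis trit.distinct(1))
        qed
      qed
    qed
    then show "fm_eval (fm_relax {b} \<phi>) t = tf_map (layer_fun V d) (restrict t (tf_vars (layer_fun V d)))"
      by (simp only: \<phi>(4) fst_rfun)
  qed (use over \<phi> CR class_R_P3 assms rfun_P3 in auto)
  then show ?thesis using tf_closure_idem by blast
qed

section \<open>Generating layer functions\<close>

lemma rfun_cong: "(\<And>T. T \<subseteq> V \<Longrightarrow> T \<in> Z \<longleftrightarrow> T \<in> Z') \<Longrightarrow> rfun V Z = rfun V Z'"
proof -
  assume "\<And>T. T \<subseteq> V \<Longrightarrow> T \<in> Z \<longleftrightarrow> T \<in> Z'"
  then have "{x \<in> V. a x = T2} \<notin> Z \<longleftrightarrow> {x \<in> V. a x = T2} \<notin> Z'" for a :: "nat \<Rightarrow> trit"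
    by (metis (no_types, lifting) mem_Collect_eq subsetI)
  then show ?thesis by (simp add: rfun_def)
qed

text \<open>In R only the zeros inside {1,2}^V have to be compared. Taking the formula over the
  closure lets functions generated earlier serve as building blocks.\<close>

lemma rfun_in_closureI:
  assumes "A \<subseteq> class_R" "fm_over (tf_closure A) \<phi>" "fm_nontrivial \<phi>" "fm_vars \<phi> = V"
    and "\<And>t. (\<And>x. x \<in> V \<Longrightarrow> t x \<noteq> T0) \<Longrightarrow> fm_eval \<phi> t = T0 \<longleftrightarrow> {x \<in> V. t x = T2} \<in> Z"
  shows "rfun V Z \<in> tf_closure A"
proof -
  have CR: "tf_closure A \<subseteq> class_R" using tf_closure_class_R[OF assms(1)] .
  then have CP: "tf_closure A \<subseteq> P3" using class_R_P3 by blast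
  have V: "finite V" "V \<noteq> {}"
    using finite_fm_vars[OF CP assms(2)] fm_vars_nonempty[OF CP assms(2)] assms(4) by auto
  have "rfun V Z \<in> tf_closure (tf_closure A)"
  proof (rule tf_closureI[OF CP rfun_P3[OF V] assms(2,3)])
    fix t
    have v: "fm_eval \<phi> t \<in> {T0, T1}" using fm_eval_values[OF CR assms(2,3)] .
    show "fm_eval \<phi> t = tf_map (rfun V Z) (restrict t (tf_vars (rfun V Z)))"
    proof (cases "\<exists>x\<in>V. t x = T0")
      case True
      then show ?thesis using fm_eval_zero[OF CR assms(2), of _ t] assms(4) by auto
    next
      case False
      then show ?thesis using assms(5)[of t] v by auto
    qed
  qed (use assms(4) in simp)
  then show ?thesis using tf_closure_idem by blast
qed

lemma closure_rfun_vars: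
  assumes "A \<subseteq> class_R" "rfun W Z \<in> tf_closure A"
  shows "finite W" "W \<noteq> {}"
proof -
  have "rfun W Z \<in> P3" using assms tf_closure_class_R class_R_P3 by blast
  then show "finite W" "W \<noteq> {}" using P3_finite P3_nonempty by fastforce+
qed

text \<open>After identifying all variables the number of twos is 0 or \<open>card W\<close>, never
  \<open>d\<close>.\<close>

lemma support_fun_singleton:
  assumes "A \<subseteq> class_R" "layer_fun W d \<in> tf_closure A" "1 \<le> d" "d < card W"
  shows "support_fun {v} \<in> tf_closure A"
proof (rule rfun_in_closureI[OF assms(1)])
  let ?\<phi> = "FApp (layer_fun W d) (\<lambda>_. FVar v)"
  show "fm_vars ?\<phi> = {v}" using closure_rfun_vars[OF assms(1,2)] by auto
  fix t assume "\<And>x. x \<in> {v} \<Longrightarrow> t x \<noteq> T0"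
  moreover have "{w \<in> W. t v = T2} = (if t v = T2 then W else {})" by auto
  ultimately show "fm_eval ?\<phi> t = T0 \<longleftrightarrow> {x \<in> {v}. t x = T2} \<in> {}"
    using assms(3,4) by auto
qed (use assms(2) in auto)

text \<open>The inner formulas turn nonzero values into 1, so the outer function sees no twos and,
  as \<open>d\<close> is positive, gives 1. The bounds on \<open>d\<close> provide two places for
  \<open>u\<close> and \<open>v\<close>.\<close>

lemma support_fun_pair:
  assumes "A \<subseteq> class_R" "layer_fun W d \<in> tf_closure A" "1 \<le> d" "d < card W"
  shows "support_fun {u, v} \<in> tf_closure A"
proof -
  have "\<not> is_singleton W" "W \<noteq> {}" using assms by (auto simp: is_singleton_altdef)
  then obtain w0 w1 where w: "w0 \<in> W" "w1 \<in> W" "w0 \<noteq> w1" by (metis is_singletonI')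
  let ?\<phi> = "FApp (layer_fun W d) (\<lambda>w. FApp (support_fun {if w = w0 then u else v}) FVar)"
  show ?thesis
  proof (rule rfun_in_closureI[OF assms(1)])
    show "fm_vars ?\<phi> = {u, v}" using w by auto
    show "fm_over (tf_closure A) ?\<phi>"
      using support_fun_singleton[OF assms] assms(2) by auto
    fix t assume "\<And>x. x \<in> {u, v} \<Longrightarrow> t x \<noteq> T0"
    then show "fm_eval ?\<phi> t = T0 \<longleftrightarrow> {x \<in> {u, v}. t x = T2} \<in> {}"
      using assms(3) by auto
  qed auto
qed

text \<open>Nesting the binary function adds one variable at a time; identifying its variables
  starts the induction.\<close>

lemma support_fun_closure:
  assumes "A \<subseteq> class_R" "support_fun {0, 1} \<in> tf_closure A" "finite V" "V \<noteq> {}"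
  shows "support_fun V \<in> tf_closure A"
  using assms(3,4)
proof (induction V rule: finite_ne_induct)
  case (singleton x)
  show ?case
    by (rule rfun_in_closureI[OF assms(1), where \<phi> = "FApp (support_fun {0, 1}) (\<lambda>_. FVar x)"])
      (use assms(2) in auto)
next
  case (insert x V)
  let ?\<phi> = "FApp (support_fun {0, 1}) (\<lambda>i. if i = 0 then FVar x else FApp (support_fun V) FVar)"
  show ?case
    by (rule rfun_in_closureI[OF assms(1), where \<phi> = ?\<phi>]) (use assms(2) insert in auto)
qed

text \<open>On arguments from {0,1} a layer function with positive \<open>d\<close> is a
  conjunction, so the zero sets of the arguments are united.\<close>

lemma rfun_Union_closure:
  assumes "A \<subseteq> class_R" "layer_fun W d \<in> tf_closure A" "1 \<le> d"
    and "I \<noteq> {}" "finite I" "card I \<le> card W" "\<And>i. i \<in> I \<Longrightarrow> rfun V (Z i) \<in> tf_closure A"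
  shows "rfun V (\<Union>i\<in>I. Z i) \<in> tf_closure A"
proof -
  obtain h where h: "h ` I \<subseteq> W" "inj_on h I"
    using card_le_inj[OF assms(5) closure_rfun_vars(1)[OF assms(1,2)] assms(6)] by auto
  obtain i0 where i0: "i0 \<in> I" using assms(4) by auto
  \<comment> \<open>A surjection of the places \<open>W\<close> onto \<open>I\<close>; surplus
    places repeat the member \<open>i0\<close>.\<close>
  define \<pi> where "\<pi> w = (if w \<in> h ` I then inv_into I h w else i0)" for w
  have \<pi>: "\<pi> ` W = I"
  proof
    show "\<pi> ` W \<subseteq> I" using i0 by (auto simp: \<pi>_def h inv_into_f_f)
    show "I \<subseteq> \<pi> ` W"
    proof
      fix i assume "i \<in> I"
      then have "\<pi> (h i) = i" "h i \<in> W" using h by (auto simp: \<pi>_def)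
      then show "i \<in> \<pi> ` W" by (metis image_eqI)
    qed
  qed
  let ?\<phi> = "FApp (layer_fun W d) (\<lambda>w. FApp (rfun V (Z (\<pi> w))) FVar)"
  show ?thesis
  proof (rule rfun_in_closureI[OF assms(1)])
    show "fm_vars ?\<phi> = V" using \<pi> i0 by auto
    show "fm_over (tf_closure A) ?\<phi>" using assms(2,7) \<pi> by auto
    fix t assume "\<And>x. x \<in> V \<Longrightarrow> t x \<noteq> T0"
    then show "fm_eval ?\<phi> t = T0 \<longleftrightarrow> {x \<in> V. t x = T2} \<in> (\<Union>i\<in>I. Z i)"
      using assms(3) \<pi>[symmetric] by auto
  qed auto
qed

text \<open>Each \<open>v \<in> V\<close> is substituted for \<open>m v\<close> variables of the layer function; the remaining
  places are filled by formulas that equal 1 on \<open>{1,2}\<^sup>V\<close>.\<close>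

lemma rfun_weights_closure:
  assumes "A \<subseteq> class_R" "layer_fun W d \<in> tf_closure A" "finite V" "V \<noteq> {}"
    and "\<And>v. v \<in> V \<Longrightarrow> 0 < m v" "sum m V \<le> card W"
    and "sum m V < card W \<Longrightarrow> 1 \<le> d \<and> d < card W"
  shows "rfun V {T. sum m T = d} \<in> tf_closure A"
proof -
  let ?S = "\<lambda>T. Sigma T (\<lambda>v. {..<m v})"
  have finW: "finite W" using closure_rfun_vars[OF assms(1,2)] by simp
  have cS: "card (?S T) = sum m T" if "T \<subseteq> V" for T
    using finite_subset[OF that assms(3)] by simp
  have "finite (?S V)" using assms(3) by simp
  then obtain h where h: "h ` ?S V \<subseteq> W" "inj_on h (?S V)"
    using card_le_inj[of "?S V" W] finW cS[of V] assms(6) by auto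
  obtain v0 where v0: "v0 \<in> V" using assms(4) by auto
  define \<sigma> where "\<sigma> w = (if w \<in> h ` ?S V then FVar (fst (inv_into (?S V) h w))
      else FApp (support_fun {v0}) FVar)" for w
  have \<sigma>_h: "\<sigma> (h p) = FVar (fst p)" if "p \<in> ?S V" for p
    using that h(2) by (simp add: \<sigma>_def)
  have \<sigma>_out: "\<sigma> w = FApp (support_fun {v0}) FVar" if "w \<notin> h ` ?S V" for w
    using that by (simp add: \<sigma>_def)
  \<comment> \<open>An unfilled place means that the total weight is below \<open>card W\<close>,
    exactly when the last hypothesis supplies the padding function.\<close>
  have pad: "support_fun {v0} \<in> tf_closure A" if "w \<in> W" "w \<notin> h ` ?S V" for w
  proof -
    have "card (h ` ?S V) < card W" using that h(1) finW by (intro psubset_card_mono) auto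
    then have "sum m V < card W" using card_image[OF h(2)] cS[of V] by simp
    then show ?thesis using support_fun_singleton[OF assms(1,2)] assms(7) by auto
  qed
  let ?\<phi> = "FApp (layer_fun W d) \<sigma>"
  show ?thesis
  proof (rule rfun_in_closureI[OF assms(1)])
    have "fm_over (tf_closure A) (\<sigma> w)" if "w \<in> W" for w
      using pad[OF that] \<sigma>_h \<sigma>_out[of w] by (cases "w \<in> h ` ?S V") auto
    then show "fm_over (tf_closure A) ?\<phi>" using assms(2) by simp
    have "fm_vars (\<sigma> w) \<subseteq> V" for w
      using \<sigma>_h \<sigma>_out[of w] v0 by (cases "w \<in> h ` ?S V") auto
    moreover have "v \<in> (\<Union>w\<in>W. fm_vars (\<sigma> w))" if "v \<in> V" for v
    proof -
      \<comment> \<open>Positive weights ensure that every variable of \<open>V\<close> really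
        occurs.\<close>
      have "(v, 0) \<in> ?S V" using that assms(5) by auto
      then have "h (v, 0) \<in> W" "v \<in> fm_vars (\<sigma> (h (v, 0)))" using h(1) \<sigma>_h by auto
      then show ?thesis by blast
    qed
    ultimately show "fm_vars ?\<phi> = V" by auto
    fix t assume t: "\<And>x. x \<in> V \<Longrightarrow> t x \<noteq> T0"
    let ?T = "{x \<in> V. t x = T2}"
    have nz: "fm_eval (\<sigma> w) t \<noteq> T0" for w
      using \<sigma>_h \<sigma>_out[of w] t v0 by (cases "w \<in> h ` ?S V") auto
    \<comment> \<open>Padded places have value 1, so the twos seen by the layer function are exactly
      the copies of variables in \<open>?T\<close>.\<close>
    have "{w \<in> W. fm_eval (\<sigma> w) t = T2} = h ` ?S ?T"
    proof (intro equalityI subsetI)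
      fix w assume w: "w \<in> {w \<in> W. fm_eval (\<sigma> w) t = T2}"
      have "w \<in> h ` ?S V"
      proof (rule ccontr)
        assume "w \<notin> h ` ?S V"
        then show False using w \<sigma>_out[of w] t[OF v0] by simp
      qed
      then obtain p where "p \<in> ?S V" "w = h p" by blast
      then show "w \<in> h ` ?S ?T" using w \<sigma>_h[of p] by (auto intro!: imageI)
    next
      fix w assume "w \<in> h ` ?S ?T"
      then obtain p where p: "p \<in> ?S ?T" "w = h p" by blast
      then have "p \<in> ?S V" by auto
      then show "w \<in> {w \<in> W. fm_eval (\<sigma> w) t = T2}" using p h(1) \<sigma>_h[of p] by auto
    qed
    moreover have "card (h ` ?S ?T) = sum m ?T"
      using h(2) cS[of ?T] by (subst card_image) (auto intro: inj_on_subset)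
    ultimately show "fm_eval ?\<phi> t = T0 \<longleftrightarrow> ?T \<in> {T. sum m T = d}"
      using nz by simp
  qed simp
qed

lemma sum_one_heavy:
  assumes "finite T"
  shows "(\<Sum>v\<in>T. if v = u then k + 1 else 1) = card T + (if u \<in> T then k else (0::nat))"
proof -
  have "(\<Sum>v\<in>T. if v = u then k + 1 else 1) = (\<Sum>v\<in>T. 1 + (if v = u then k else 0))"
    by (intro sum.cong) auto
  then show ?thesis using assms by (simp only: sum.distrib sum.delta) simp
qed

text \<open>All weights are 1 except \<open>k + 1\<close> at one variable \<open>u\<close>. For
  \<open>d = 0\<close> the surplus multiplicity goes to \<open>u\<close>, since weight 0 still means
  no twos. For \<open>d = d'\<close> positive, weights 1 with padding suffice.\<close>

lemma layer_fun_closure: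
  assumes "A \<subseteq> class_R" "layer_fun W d \<in> tf_closure A" "finite V" "V \<noteq> {}"
    and "d \<le> card W" "d' \<le> card V" "card V - d' \<le> card W - d"
    and "d = d' \<or> 1 \<le> d' \<and> card V \<le> d"
  shows "layer_fun V d' \<in> tf_closure A"
proof -
  let ?m = "\<lambda>u k v. if v = u then k + 1 else (1::nat)"
  have weight: "rfun V {T. sum (?m u k) T = d} \<in> tf_closure A"
    if "u \<in> V" "card V + k \<le> card W" "card V + k < card W \<Longrightarrow> 1 \<le> d \<and> d < card W" for u k
    using assms(1-4) that by (intro rfun_weights_closure) (auto simp: sum_one_heavy[OF assms(3)])
  have finT: "finite T" if "T \<subseteq> V" for T using finite_subset[OF that assms(3)] .
  obtain u where u: "u \<in> V" using assms(4) by auto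
  consider "d = 0" "d' = 0" | "d = d'" "1 \<le> d" | "1 \<le> d'" "card V \<le> d" using assms(8) by linarith
  then show ?thesis
  proof cases
    case 1
    then have "rfun V {T. sum (?m u (card W - card V)) T = d} \<in> tf_closure A"
      using u assms(7) by (intro weight) auto
    moreover have "rfun V {T. sum (?m u (card W - card V)) T = d} = layer_fun V d'"
    proof (rule rfun_cong)
      fix T assume "T \<subseteq> V"
      then show "T \<in> {T. sum (?m u (card W - card V)) T = d} \<longleftrightarrow> T \<in> {T. card T = d'}"
        using finT 1 by (auto simp: sum_one_heavy)
    qed
    ultimately show ?thesis by simp
  next
    case 2
    then have "rfun V {T. sum (?m u 0) T = d} \<in> tf_closure A"
      using u assms(5-7) by (intro weight) auto
    moreover have "rfun V {T. sum (?m u 0) T = d} = layer_fun V d'"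
      using finT 2 by (intro rfun_cong) (auto simp: sum_one_heavy)
    ultimately show ?thesis by simp
  next
    case 3
    \<comment> \<open>With extra weight \<open>d - d'\<close> at \<open>u\<close>, total
      \<open>d\<close> means that \<open>T\<close> contains \<open>u\<close> and has
      \<open>d'\<close> elements: a set avoiding \<open>u\<close> has fewer than
      \<open>card V\<close>, hence fewer than \<open>d\<close>, elements. Uniting over
      \<open>u\<close> gives the whole layer because \<open>d'\<close> is positive.\<close>
    have "rfun V (\<Union>u\<in>V. {T. sum (?m u (d - d')) T = d}) \<in> tf_closure A"
    proof (rule rfun_Union_closure[OF assms(1,2)])
      show "rfun V {T. sum (?m u (d - d')) T = d} \<in> tf_closure A" if "u \<in> V" for u
        using that assms(5-7) 3 by (intro weight) auto
    qed (use 3 assms in auto)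
    moreover have "rfun V (\<Union>u\<in>V. {T. sum (?m u (d - d')) T = d}) = layer_fun V d'"
    proof (rule rfun_cong)
      fix T assume T: "T \<subseteq> V"
      have "sum (?m u (d - d')) T = d \<longleftrightarrow> u \<in> T \<and> card T = d'" if "u \<in> V" for u
      proof (cases "u \<in> T")
        case True
        then show ?thesis using finT[OF T] 3 assms(6) by (auto simp: sum_one_heavy)
      next
        case False
        then have "card T < card V" using T that assms(3) by (intro psubset_card_mono) auto
        then show ?thesis using False finT[OF T] 3 by (auto simp: sum_one_heavy)
      qed
      moreover have "T \<noteq> {}" if "card T = d'" using that 3 by auto
      ultimately show "T \<in> (\<Union>u\<in>V. {T. sum (?m u (d - d')) T = d}) \<longleftrightarrow> T \<in> {T. card T = d'}"
        using T by auto
    qed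
    ultimately show ?thesis by simp
  qed
qed

section \<open>Layers consisting of a single tuple\<close>

text \<open>Descend through nontrivial arguments to an application whose arguments are all
  variables, described by \<open>\<pi>\<close>. Functions of R pass its zeros up to the
  root.\<close>

lemma fm_leaf:
  assumes "A \<subseteq> class_R"
  shows "fm_over A \<phi> \<Longrightarrow> fm_nontrivial \<phi> \<Longrightarrow> \<exists>g\<in>A. \<exists>\<pi>. \<pi> ` tf_vars g \<subseteq> fm_vars \<phi> \<and>
    (\<forall>a. fm_eval \<phi> a \<noteq> T0 \<longrightarrow> tf_map g (\<lambda>x\<in>tf_vars g. a (\<pi> x)) \<noteq> T0)"
proof (induction \<phi>)
  case (FApp g \<sigma>)
  have R: "g \<in> class_R" using FApp.prems assms by auto
  show ?case
  proof (cases "\<exists>x\<in>tf_vars g. fm_nontrivial (\<sigma> x)")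
    case True
    then obtain x where x: "x \<in> tf_vars g" "fm_nontrivial (\<sigma> x)" by auto
    have "fm_eval (\<sigma> x) a \<noteq> T0" if "fm_eval (FApp g \<sigma>) a \<noteq> T0" for a
      using class_R_zero[OF R x(1), of "\<lambda>x. fm_eval (\<sigma> x) a"] that by auto
    moreover have "fm_over A (\<sigma> x)" "fm_vars (\<sigma> x) \<subseteq> fm_vars (FApp g \<sigma>)"
      using x FApp.prems by auto
    ultimately show ?thesis using FApp.IH[of "\<sigma> x"] x(2) by (meson order_trans rangeI)
  next
    case False
    then have "\<forall>x\<in>tf_vars g. \<exists>y. \<sigma> x = FVar y" by (auto simp: fm_nontrivial_def)
    then obtain \<pi> where \<pi>: "\<forall>x\<in>tf_vars g. \<sigma> x = FVar (\<pi> x)" by metis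
    have "(\<lambda>x\<in>tf_vars g. fm_eval (\<sigma> x) a) = (\<lambda>x\<in>tf_vars g. a (\<pi> x))" for a
      using \<pi> by (intro restrict_ext) auto
    moreover have "\<pi> ` tf_vars g \<subseteq> fm_vars (FApp g \<sigma>)" using \<pi> by auto
    moreover have "g \<in> A" using FApp.prems by simp
    ultimately show ?thesis by (metis fm_eval.simps(2))
  qed
qed simp

text \<open>A constant assignment stays constant under substitution of variables, so the innermost
  function vanishes there and with it the formula.\<close>

lemma closure_const_zero:
  assumes "A \<subseteq> class_R"
    and "\<And>g. g \<in> A \<Longrightarrow> \<exists>c\<in>{T1, T2}. tf_map g (\<lambda>x\<in>tf_vars g. c) = T0"
    and "f \<in> tf_closure A"
  shows "\<exists>c\<in>{T1, T2}. tf_map f (\<lambda>x\<in>tf_vars f. c) = T0"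
proof -
  obtain \<phi> where \<phi>: "fm_over A \<phi>" "fm_nontrivial \<phi>"
    "\<And>t. fm_eval \<phi> t = tf_map f (restrict t (tf_vars f))"
    using assms(3) by (rule tf_closureE) (rule that)
  obtain g \<pi> where g: "g \<in> A"
    "\<And>a. fm_eval \<phi> a \<noteq> T0 \<Longrightarrow> tf_map g (\<lambda>x\<in>tf_vars g. a (\<pi> x)) \<noteq> T0"
    using fm_leaf[OF assms(1) \<phi>(1,2)] by blast
  obtain c where c: "c \<in> {T1, T2}" "tf_map g (\<lambda>x\<in>tf_vars g. c) = T0"
    using assms(2)[OF g(1)] by blast
  then have "fm_eval \<phi> (\<lambda>_. c) = T0" using g(2)[of "\<lambda>_. c"] by auto
  then show ?thesis using c(1) \<phi>(3)[of "\<lambda>_. c"] by (intro bexI[of _ c]) (simp only:)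
qed

text \<open>The formula vanishes whenever the variables \<open>W\<close> of an innermost application
  equal \<open>c\<close>. If \<open>W\<close> were not all of \<open>V\<close>, the other nonzero
  value outside \<open>W\<close> would give a zero off the layer. So \<open>W = V\<close>, and that
  application alone has the required single zero in {1,2}^V.\<close>

lemma singleton_layer_closure:
  assumes "B \<subseteq> class_R" "finite V" "d \<in> {0, card V}" "layer_fun V d \<in> tf_closure B"
    and "\<And>g. g \<in> B \<Longrightarrow> \<exists>c\<in>{T1, T2}. tf_map g (\<lambda>x\<in>tf_vars g. c) = T0"
  shows "\<exists>g\<in>B. layer_fun V d \<in> tf_closure {g}"
proof -
  obtain \<phi> where \<phi>: "fm_over B \<phi>" "fm_nontrivial \<phi>" "fm_vars \<phi> = V"
    "\<And>t. fm_eval \<phi> t = tf_map (layer_fun V d) (restrict t V)"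
    using assms(4) by (rule tf_closureE[where f = "layer_fun V d", unfolded fst_rfun]) (rule that)
  obtain g \<pi> where g: "g \<in> B" "\<pi> ` tf_vars g \<subseteq> V"
    "\<And>a. fm_eval \<phi> a \<noteq> T0 \<Longrightarrow> tf_map g (\<lambda>x\<in>tf_vars g. a (\<pi> x)) \<noteq> T0"
    using fm_leaf[OF assms(1) \<phi>(1,2)] \<phi>(3) by blast
  have R: "g \<in> class_R" using g(1) assms(1) by auto
  obtain c where c: "c \<in> {T1, T2}" "tf_map g (\<lambda>x\<in>tf_vars g. c) = T0"
    using assms(5)[OF g(1)] by blast
  define W where "W = \<pi> ` tf_vars g"
  have W: "W \<subseteq> V" "W \<noteq> {}" using g(2) R class_R_P3 P3_nonempty[of g] by (auto simp: W_def)
  define a where "a = (\<lambda>x. if x \<in> W then c else if c = T1 then T2 else T1)"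
  have "(\<lambda>x\<in>tf_vars g. a (\<pi> x)) = (\<lambda>x\<in>tf_vars g. c)"
    by (intro restrict_ext) (auto simp: a_def W_def)
  then have "fm_eval \<phi> a = T0" using g(3)[of a] c(2) by auto
  moreover have "\<forall>x\<in>V. a x \<noteq> T0" using c(1) by (auto simp: a_def)
  ultimately have card_a: "card {x \<in> V. a x = T2} = d" unfolding \<phi>(4) by (auto split: if_splits)
  have Ta: "{x \<in> V. a x = T2} = (if c = T1 then V - W else W)"
    using c(1) W(1) by (auto simp: a_def)
  have "W = V"
  proof (rule ccontr)
    assume "W \<noteq> V"
    then have "0 < card W" "card W < card V" using W assms(2)
      by (auto simp: card_gt_0_iff finite_subset intro!: psubset_card_mono)
    moreover have "card (V - W) = card V - card W"
      using W assms(2) by (intro card_Diff_subset) (auto simp: finite_subset)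
    ultimately show False using card_a Ta assms(3) by (auto split: if_splits)
  qed
  then have d: "d = (if c = T1 then 0 else card V)" using card_a Ta by auto
  have V: "V \<noteq> {}" using W by auto
  let ?\<psi> = "FApp g (\<lambda>x. FVar (\<pi> x))"
  have "layer_fun V d \<in> tf_closure {g}"
  proof (rule rfun_in_closureI[where \<phi> = ?\<psi>])
    show "fm_over (tf_closure {g}) ?\<psi>"
      using subset_tf_closure[of "{g}"] R class_R_P3 by auto
    show "fm_vars ?\<psi> = V" using \<open>W = V\<close> by (auto simp: W_def)
    fix t assume t: "\<And>x. x \<in> V \<Longrightarrow> t x \<noteq> T0"
    show "fm_eval ?\<psi> t = T0 \<longleftrightarrow> {x \<in> V. t x = T2} \<in> {T. card T = d}"
    proof
      assume "fm_eval ?\<psi> t = T0"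
      then have "fm_eval \<phi> t = T0" using g(3)[of t] by auto
      then show "{x \<in> V. t x = T2} \<in> {T. card T = d}"
        unfolding \<phi>(4) using t by (auto split: if_splits)
    next
      assume "{x \<in> V. t x = T2} \<in> {T. card T = d}"
      then have card_t: "card {x \<in> V. t x = T2} = d" by simp
      have "t x = c" if "x \<in> V" for x
      proof (cases "c = T1")
        case True
        then have "{x \<in> V. t x = T2} = {}" using card_t d assms(2) by auto
        then show ?thesis using that t[OF that] True by (auto simp: trit_cases_nonzero)
      next
        case False
        then have "{x \<in> V. t x = T2} = V"
          using card_t d assms(2) by (intro card_subset_eq) auto
        then show ?thesis using that c(1) False by auto
      qed
      then have "(\<lambda>x\<in>tf_vars g. t (\<pi> x)) = (\<lambda>x\<in>tf_vars g. c)"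
        using g(2) by (intro restrict_ext) auto
      then show "fm_eval ?\<psi> t = T0" using c(2) by simp
    qed
  qed (use R in auto)
  then show ?thesis using g(1) by blast
qed

section \<open>Bases\<close>

text \<open>\<open>dominates p q\<close> is the relation between the parameters \<open>(e, d)\<close> of layer functions for
  which \<open>layer_fun_closure\<close> derives the function with parameters \<open>p\<close> from the one with
  parameters \<open>q\<close>. It is stricter than the product order, but still has no infinite antichains.\<close>

definition dominates :: "nat \<times> nat \<Rightarrow> nat \<times> nat \<Rightarrow> bool" where
  "dominates p q \<longleftrightarrow> fst p \<le> fst q \<and>
     (snd q = snd p \<or> 1 \<le> snd p \<and> fst p + snd p \<le> snd q)"

text \<open>If some second component \<open>d\<close> occurs infinitely often, any pair with it will
  do, as only finitely many first components are smaller. Otherwise second components are unbounded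
  outside every finite set, and a pair of least first component among those with positive second one
  works.\<close>

lemma infinite_dominates:
  assumes "infinite X"
  shows "\<exists>p\<in>X. infinite {q \<in> X. dominates p q}"
proof (cases "\<exists>d. infinite {e. (e, d) \<in> X}")
  case True
  then obtain d where d: "infinite {e. (e, d) \<in> X}" by auto
  then obtain e where e: "(e, d) \<in> X" using not_finite_existsD by blast
  have "infinite ({e. (e, d) \<in> X} - {..<e})" using d by simp
  then have "infinite ((\<lambda>e. (e, d)) ` ({e. (e, d) \<in> X} - {..<e}))"
    by (subst finite_image_iff) (auto simp: inj_on_def)
  moreover have "(\<lambda>e. (e, d)) ` ({e. (e, d) \<in> X} - {..<e}) \<subseteq> {q \<in> X. dominates (e, d) q}"
    by (auto simp: dominates_def)
  ultimately show ?thesis using e finite_subset by blast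
next
  case False
  have fin: "finite {p \<in> X. snd p < n}" for n
  proof -
    have "{p \<in> X. snd p < n} = (\<Union>d<n. (\<lambda>e. (e, d)) ` {e. (e, d) \<in> X})" by force
    then show ?thesis using False by auto
  qed
  define Y where "Y = X - {p \<in> X. snd p < 1}"
  have "infinite Y" unfolding Y_def by (intro Diff_infinite_finite fin assms)
  then obtain y where "y \<in> Y" using infinite_imp_nonempty by blast
  then obtain p where p: "p \<in> Y" "\<And>q. q \<in> Y \<Longrightarrow> fst p \<le> fst q"
    using ex_has_least_nat[of "\<lambda>q. q \<in> Y" y fst] by blast
  have "infinite (Y - {q \<in> X. snd q < fst p + snd p})"
    using \<open>infinite Y\<close> by (intro Diff_infinite_finite fin)
  moreover have "Y - {q \<in> X. snd q < fst p + snd p} \<subseteq> {q \<in> X. dominates p q}"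
    using p by (auto simp: dominates_def Y_def)
  ultimately show ?thesis using p(1) finite_subset unfolding Y_def by blast
qed

text \<open>Take an inclusion-minimal generating subset of \<open>F\<close>.\<close>

lemma finite_has_basis:
  assumes "finite F" "F \<subseteq> P3"
  shows "\<exists>B\<subseteq>F. tf_basis B (tf_closure F)"
proof -
  define S where "S = {A. A \<subseteq> F \<and> tf_closure A = tf_closure F}"
  have "finite S" "S \<noteq> {}" using assms(1) by (auto simp: S_def)
  then obtain B where B: "B \<in> S" "\<forall>A\<in>S. A \<subseteq> B \<longrightarrow> B = A"
    by (rule finite_has_minimal[THEN bexE]) (rule that)
  have "tf_closure B' \<noteq> tf_closure F" if "B' \<subset> B" for B'
    using B that by (auto simp: S_def)
  then show ?thesis using B(1) assms(2) unfolding tf_basis_def S_def by blast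
qed

lemma infinite_no_basis:
  assumes F: "F \<subseteq> class_S_minus1"
    and cong: "\<And>f g. f \<in> F \<Longrightarrow> g \<in> F \<Longrightarrow> tf_congruent f g \<Longrightarrow> f = g"
    and inf: "infinite F" and B: "tf_basis B (tf_closure F)"
  shows False
proof -
  have FR: "F \<subseteq> class_R" using F by (auto simp: class_S_minus1_def)
  have FP: "F \<subseteq> P3" using FR class_R_P3 by blast
  have "\<forall>f\<in>F. \<exists>d \<le> card (tf_vars f). f = layer_fun (tf_vars f) d"
    using F class_S_minus1_layer_fun by blast
  then obtain d where d: "\<And>f. f \<in> F \<Longrightarrow> d f \<le> card (tf_vars f)"
    "\<And>f. f \<in> F \<Longrightarrow> f = layer_fun (tf_vars f) (d f)"
    by metis
  have V: "finite (tf_vars f)" "tf_vars f \<noteq> {}" if "f \<in> F" for f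
    using that FP P3_finite[of f] P3_nonempty[of f] by auto
  define p where "p f = (card (tf_vars f) - d f, d f)" for f :: tfun
  have inj: "inj_on p F"
  proof (rule inj_onI)
    fix f g assume fg: "f \<in> F" "g \<in> F" "p f = p g"
    then have "d f = d g" "card (tf_vars f) = card (tf_vars g)"
      using d(1)[of f] d(1)[of g] by (auto simp: p_def)
    then have "tf_congruent f g"
      using layer_fun_congruent[of "tf_vars f" "tf_vars g" "d f"] V fg(1,2) d(2) by metis
    then show "f = g" using cong fg by blast
  qed
  have small: "finite {f \<in> F. card (tf_vars f) \<le> N}" for N
  proof (rule finite_imageD)
    show "inj_on p {f \<in> F. card (tf_vars f) \<le> N}" using inj by (rule inj_on_subset) auto
    have "p ` {f \<in> F. card (tf_vars f) \<le> N} \<subseteq> {..N} \<times> {..N}"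
      using d(1) by (force simp: p_def)
    then show "finite (p ` {f \<in> F. card (tf_vars f) \<le> N})" by (rule finite_subset) auto
  qed
  have large: "\<exists>f\<in>H. N < card (tf_vars f)" if "infinite H" "H \<subseteq> F" for H N
  proof (rule ccontr)
    assume "\<not> ?thesis"
    then have "H \<subseteq> {f \<in> F. card (tf_vars f) \<le> N}" using that(2) by force
    then show False using small that(1) finite_subset by blast
  qed
  have not_cert: "\<not> zero_cert N f" if "f \<in> F" "N < card (tf_vars f)" for f N
    using not_zero_cert_layer_fun[of "tf_vars f" N "d f"] V d that by metis

  have BP: "B \<subseteq> P3" and clB: "tf_closure B = tf_closure F"
    and min: "\<And>B'. B' \<subset> B \<Longrightarrow> tf_closure B' \<noteq> tf_closure F"
    using B by (auto simp: tf_basis_def)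
  have BF: "B \<subseteq> tf_closure F" using subset_tf_closure[OF BP] clB by simp
  have BR: "B \<subseteq> class_R" using BF tf_closure_class_R[OF FR] by blast
  have FB: "F \<subseteq> tf_closure B" using subset_tf_closure[OF FP] clB by simp
  have "infinite B"
  proof
    assume fin: "finite B"
    \<comment> \<open>Inserting 1 keeps \<open>Max\<close> meaningful for empty \<open>B\<close> and
      makes \<open>N\<close> positive.\<close>
    define N where "N = Max (insert 1 ((\<lambda>b. card (tf_vars b)) ` B))"
    have N: "1 \<le> N" "\<And>b. b \<in> B \<Longrightarrow> card (tf_vars b) \<le> N" using fin by (auto simp: N_def)
    obtain f where f: "f \<in> F" "N < card (tf_vars f)" using large[OF inf, of N] by auto
    have "zero_cert N f"
      using zero_cert_closure[OF BR _ N(1)] N(2) zero_cert_card f(1) FB by blast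
    then show False using not_cert f by blast
  qed

  \<comment> \<open>Any other member of \<open>F\<close> can be derived from members with
    arbitrarily many variables. An infinite \<open>bad\<close> would contradict
    \<open>infinite_dominates\<close>.\<close>
  define bad where "bad = {f \<in> F. finite {g \<in> F. dominates (p f) (p g)}}"
  have "finite bad"
  proof (rule ccontr)
    assume "infinite bad"
    then have "infinite (p ` bad)"
      using inj by (subst finite_image_iff) (auto simp: bad_def intro: inj_on_subset)
    then obtain f where f: "f \<in> bad" "infinite {q \<in> p ` bad. dominates (p f) q}"
      using infinite_dominates by blast
    moreover have "{q \<in> p ` bad. dominates (p f) q} \<subseteq> p ` {g \<in> F. dominates (p f) (p g)}"
      by (auto simp: bad_def)
    ultimately show False using finite_subset by (auto simp: bad_def)
  qed
  \<comment> \<open>Some member of \<open>F\<close> omits a layer of more than one tuple; only then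
    is the support function put into \<open>H\<close>.\<close>
  define mixed where "mixed \<longleftrightarrow> (\<exists>f\<in>F. 1 \<le> d f \<and> d f < card (tf_vars f))"
  define H where "H = bad \<union> (if mixed then {support_fun {0, 1}} else {})"
  have "support_fun {0, 1} \<in> tf_closure F" if mixed
  proof -
    obtain f where f: "f \<in> F" "1 \<le> d f" "d f < card (tf_vars f)" using \<open>mixed\<close> mixed_def by auto
    then have "layer_fun (tf_vars f) (d f) \<in> tf_closure F"
      using d(2) subset_tf_closure[OF FP] by auto
    then show ?thesis using support_fun_pair[OF FR] f by blast
  qed
  then have HB: "H \<subseteq> tf_closure B" using FB clB by (auto simp: H_def bad_def)
  have finH: "finite H" using \<open>finite bad\<close> by (simp add: H_def)
  obtain B0 where B0: "finite B0" "B0 \<subseteq> B" "H \<subseteq> tf_closure B0"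
    using tf_closure_finite_subset[OF BP finH HB] by auto
  obtain b where b: "b \<in> B" "b \<notin> B0" using \<open>infinite B\<close> B0 by (metis finite_subset subsetI)
  let ?C = "tf_closure (B - {b})"
  have BbR: "B - {b} \<subseteq> class_R" using BR by auto
  have HC: "H \<subseteq> ?C" using B0 b tf_closure_mono[of B0 "B - {b}"] by blast
  define N where "N = card (tf_vars b)"
  have cert: "zero_cert N b" by (simp add: zero_cert_card N_def)
  have bV: "finite (tf_vars b)" "tf_vars b \<noteq> {}" using b BP P3_finite[of b] P3_nonempty[of b] by auto
  then have "1 \<le> N" by (simp add: N_def Suc_le_eq card_gt_0_iff)
  have high: "f \<in> ?C" if f: "f \<in> F" "N < card (tf_vars f)" for f
  proof (cases mixed)
    case True
    then have "support_fun {0, 1} \<in> ?C" using HC by (simp add: H_def)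
    then have "support_fun (tf_vars b) \<in> ?C" using support_fun_closure[OF BbR] bV by blast
    then show ?thesis
      using layer_fun_closure_relax[OF BR, of "tf_vars f" "d f" N b] f d V cert FB by auto
  next
    case False
    have const: "\<exists>c\<in>{T1, T2}. tf_map g (\<lambda>x\<in>tf_vars g. c) = T0" if g: "g \<in> F" for g
    proof -
      have "d g = 0 \<or> d g = card (tf_vars g)" using False g d(1)[OF g] by (force simp: mixed_def)
      then have "tf_map (layer_fun (tf_vars g) (d g)) (\<lambda>x\<in>tf_vars g. T1) = T0 \<or>
          tf_map (layer_fun (tf_vars g) (d g)) (\<lambda>x\<in>tf_vars g. T2) = T0"
        by auto
      then show ?thesis using d(2)[OF g] by (metis insertCI)
    qed
    have constB: "\<exists>c\<in>{T1, T2}. tf_map g (\<lambda>x\<in>tf_vars g. c) = T0" if "g \<in> B" for g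
      using closure_const_zero[OF FR const subsetD[OF BF that]] .
    have "d f \<in> {0, card (tf_vars f)}" using False f d(1)[of f] by (force simp: mixed_def)
    moreover have "layer_fun (tf_vars f) (d f) \<in> tf_closure B"
      using subsetD[OF FB f(1)] d(2)[OF f(1), symmetric] by simp
    ultimately have "\<exists>g\<in>B. layer_fun (tf_vars f) (d f) \<in> tf_closure {g}"
      using singleton_layer_closure[OF BR V(1)[OF f(1)] _ _ constB] by blast
    then obtain g where g: "g \<in> B" "f \<in> tf_closure {g}"
      unfolding d(2)[OF f(1), symmetric] by (rule bexE) (rule that)
    \<comment> \<open>Functions generated by \<open>b\<close> have zero certificates of size
      \<open>N\<close>, too small for \<open>f\<close>.\<close>
    have "g \<noteq> b"
    proof
      assume "g = b"
      then have "zero_cert N f"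
        using zero_cert_closure[of "{b}" N f] g BR cert \<open>1 \<le> N\<close> by auto
      then show False using not_cert f by blast
    qed
    then show ?thesis using g tf_closure_mono[of "{g}" "B - {b}"] by blast
  qed
  have "F \<subseteq> ?C"
  proof
    fix f assume f: "f \<in> F"
    show "f \<in> ?C"
    proof (cases "f \<in> bad")
      case True
      then show ?thesis using HC by (auto simp: H_def)
    next
      case False
      \<comment> \<open>Infinitely many candidates exist, so one has more than \<open>N\<close>
        variables and falls under \<open>high\<close>.\<close>
      then obtain g where g: "g \<in> F" "dominates (p f) (p g)" "N < card (tf_vars g)"
        using large[of "{g \<in> F. dominates (p f) (p g)}" N] f by (auto simp: bad_def)
      have "layer_fun (tf_vars g) (d g) \<in> ?C"
        using high[OF g(1,3)] by (simp only: d(2)[OF g(1), symmetric])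
      moreover have "card (tf_vars f) - d f \<le> card (tf_vars g) - d g"
        "d g = d f \<or> 1 \<le> d f \<and> card (tf_vars f) \<le> d g"
        using g(2) d(1)[OF f] unfolding dominates_def p_def fst_conv snd_conv by linarith+
      ultimately have "layer_fun (tf_vars f) (d f) \<in> ?C"
        using layer_fun_closure[OF BbR _ V[OF f] d(1)[OF g(1)] d(1)[OF f]] by blast
      then show ?thesis by (simp only: d(2)[OF f, symmetric])
    qed
  qed
  then have "tf_closure F \<subseteq> ?C" by (rule tf_closure_subsetI)
  moreover have "?C \<subseteq> tf_closure F" using tf_closure_mono[of "B - {b}" B] clB by auto
  ultimately show False using min[of "B - {b}"] b by auto
qed

theorem theorem0p23:
  fixes F G :: "tfun set"
  assumes "F \<subseteq> class_S_minus1"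
    and "\<And>f g. f \<in> F \<Longrightarrow> g \<in> F \<Longrightarrow> tf_congruent f g \<Longrightarrow> f = g"
    and "G = tf_closure F"
  shows "((\<exists>B. tf_basis B G \<and> finite B) \<longleftrightarrow> finite F) \<and>
         ((\<nexists>B. tf_basis B G) \<longleftrightarrow> infinite F)"
proof -
  have "F \<subseteq> P3" using assms(1) class_R_P3 by (auto simp: class_S_minus1_def)
  then have "\<exists>B. tf_basis B G \<and> finite B" if "finite F"
    using finite_has_basis[OF that] that assms(3) finite_subset by blast
  moreover have "\<nexists>B. tf_basis B G" if "infinite F"
    using infinite_no_basis[OF assms(1,2) that] assms(3) by blast
  ultimately show ?thesis by blast
qed

end
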